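(* Let $B$ be a locale. The assignment from homomorphisms $h$ to their adjoints $h^\dagger$ is a strong self-duality $(-)^\dagger:(B\text{-}\mathbf{HMB})^{\mathrm{op}}\to B\text{-}\mathbf{HMB}$.
   Context: A $B$-module is a complete lattice $X$ with an action $B\times X\to X$, $(b,x)\mapsto bx$, preserving arbitrary joins in each variable and satisfying $1x=x$ and $(b\wedge c)x=b(cx)$. A homomorphism of $B$-modules preserves arbitrary joins and the action. A Hilbert $B$-module is a $B$-module $X$ with a function $\langle-,-\rangle:X\times X\to B$ (inner product) such that $\langle bx,y\rangle=b\wedge\langle x,y\rangle$, $\langle\bigvee_\alpha x_\alpha,y\rangle=\bigvee_\alpha\langle x_\alpha,y\rangle$, $\langle x,y\rangle=\langle y,x\rangle$, and which is non-degenerate: $\langle x,-\rangle=\langle y,-\rangle$ implies $x=y$. A Hilbert basis of $X$ is a subset $\mathit{\Gamma}\subset X$ such that $x=\bigvee_{s\in\mathit{\Gamma}}\langle x,s\rangle s$ for all $x\in X$. $B\text{-}\mathbf{HMB}$ is the category whose objects are those Hilbert $B$-modules for which there exist Hilbert bases and whose morphisms are the homomorphisms of $B$-modules. Each such morphism $h:X\to Y$ has a unique adjoint, i.e. a unique function $h^\dagger:Y\to X$ with $\langle h(x),y\rangle=\langle x,h^\dagger(y)\rangle$ for all $x\in X$, $y\in Y$, and $h^\dagger$ is again a homomorphism of $B$-modules. A strong self-duality on a category $C$ is a functor $(-)^\dagger:C^{\mathrm{op}}\to C$ that is the identity on objects and is involutive: $(h^\dagger)^\dagger=h$ for all morphisms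 $h$. *)

theory Defs
  imports "HOL-Algebra.Complete_Lattice"
begin

text \<open>The library class \<open>complete_distrib_lattice\<close> demands complete distributivity, which is
  stronger than the frame law.\<close>

class frame = complete_lattice +
  assumes inf_Sup_frame: "inf a (Sup S) = (SUP s\<in>S. inf a s)"


section \<open>Modules over a locale\<close>

record ('x, 'b) bmodule = "'x gorder" +
  act :: "'b \<Rightarrow> 'x \<Rightarrow> 'x" (infixr \<open>\<odot>\<index>\<close> 75)

record ('x, 'b) hilbert_bmodule = "('x, 'b) bmodule" +
  ip :: "'x \<Rightarrow> 'x \<Rightarrow> 'b" (\<open>\<langle>_, _\<rangle>\<index>\<close>)

locale bmodule = complete_lattice X
  for X :: "('x, 'b::frame, 'm) bmodule_scheme" (structure) +
  assumes act_closed: "x \<in> carrier X \<Longrightarrow> b \<odot> x \<in> carrier X"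
    and act_Sup_left: "x \<in> carrier X \<Longrightarrow> Sup S \<odot> x = \<Squnion>((\<lambda>b. b \<odot> x) ` S)"
    and act_Sup_right: "A \<subseteq> carrier X \<Longrightarrow> b \<odot> (\<Squnion>A) = \<Squnion>((\<lambda>x. b \<odot> x) ` A)"
    and act_one: "x \<in> carrier X \<Longrightarrow> Orderings.top \<odot> x = x"
    and act_inf: "x \<in> carrier X \<Longrightarrow> inf b c \<odot> x = b \<odot> (c \<odot> x)"

text \<open>Homomorphisms are extensional functions (\<open>undefined\<close> off the carrier of the domain), so
  that HOL equality of homomorphisms is equality of maps between the carriers.\<close>

definition bmodule_hom ::
  "('x, 'b, 'm) bmodule_scheme \<Rightarrow> ('y, 'b, 'n) bmodule_scheme \<Rightarrow> ('x \<Rightarrow> 'y) set"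
  where "bmodule_hom X Y =
    {h \<in> carrier X \<rightarrow>\<^sub>E carrier Y.
       (\<forall>A. A \<subseteq> carrier X \<longrightarrow> h (\<Squnion>\<^bsub>X\<^esub>A) = \<Squnion>\<^bsub>Y\<^esub>(h ` A)) \<and>
       (\<forall>b. \<forall>x\<in>carrier X. h (b \<odot>\<^bsub>X\<^esub> x) = b \<odot>\<^bsub>Y\<^esub> h x)}"

locale hilbert_bmodule = bmodule X
  for X :: "('x, 'b::frame, 'm) hilbert_bmodule_scheme" (structure) +
  assumes ip_act: "\<lbrakk>x \<in> carrier X; y \<in> carrier X\<rbrakk> \<Longrightarrow> \<langle>b \<odot> x, y\<rangle> = inf b \<langle>x, y\<rangle>"
    and ip_Sup: "\<lbrakk>A \<subseteq> carrier X; y \<in> carrier X\<rbrakk> \<Longrightarrow> \<langle>\<Squnion>A, y\<rangle> = (SUP x\<in>A. \<langle>x, y\<rangle>)"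
    and ip_sym: "\<lbrakk>x \<in> carrier X; y \<in> carrier X\<rbrakk> \<Longrightarrow> \<langle>x, y\<rangle> = \<langle>y, x\<rangle>"
    and ip_nondegenerate:
      "\<lbrakk>x \<in> carrier X; y \<in> carrier X; \<forall>z\<in>carrier X. \<langle>x, z\<rangle> = \<langle>y, z\<rangle>\<rbrakk> \<Longrightarrow> x = y"

definition hilbert_basis :: "('x, 'b, 'm) hilbert_bmodule_scheme \<Rightarrow> 'x set \<Rightarrow> bool"
  where "hilbert_basis X \<Gamma> \<longleftrightarrow> \<Gamma> \<subseteq> carrier X \<and>
    (\<forall>x\<in>carrier X. x = \<Squnion>\<^bsub>X\<^esub>((\<lambda>s. \<langle>x, s\<rangle>\<^bsub>X\<^esub> \<odot>\<^bsub>X\<^esub> s) ` \<Gamma>))"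

definition is_adjoint ::
  "('x, 'b, 'm) hilbert_bmodule_scheme \<Rightarrow> ('y, 'b, 'n) hilbert_bmodule_scheme \<Rightarrow>
   ('x \<Rightarrow> 'y) \<Rightarrow> ('y \<Rightarrow> 'x) \<Rightarrow> bool"
  where "is_adjoint X Y h k \<longleftrightarrow> k \<in> carrier Y \<rightarrow>\<^sub>E carrier X \<and>
    (\<forall>x\<in>carrier X. \<forall>y\<in>carrier Y. \<langle>h x, y\<rangle>\<^bsub>Y\<^esub> = \<langle>x, k y\<rangle>\<^bsub>X\<^esub>)"

definition adjoint ::
  "('x, 'b, 'm) hilbert_bmodule_scheme \<Rightarrow> ('y, 'b, 'n) hilbert_bmodule_scheme \<Rightarrow>
   ('x \<Rightarrow> 'y) \<Rightarrow> 'y \<Rightarrow> 'x"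
  where "adjoint X Y h = (THE k. is_adjoint X Y h k)"

text \<open>The definite description in \<open>adjoint\<close> is justified by existence and uniqueness.\<close>

lemma adjoint_ex1:
  assumes X: "hilbert_bmodule X" and basis: "hilbert_basis X \<Gamma>"
    and Y: "hilbert_bmodule Y" and h: "h \<in> bmodule_hom X Y"
  shows "\<exists>!k. is_adjoint X Y h k"
proof -
  interpret X: hilbert_bmodule X by (rule X)
  interpret Y: hilbert_bmodule Y by (rule Y)
  have expand: "x = \<Squnion>\<^bsub>X\<^esub>((\<lambda>s. \<langle>x, s\<rangle>\<^bsub>X\<^esub> \<odot>\<^bsub>X\<^esub> s) ` \<Gamma>)" if "x \<in> carrier X" for x
    using basis that unfolding hilbert_basis_def by blast
  have \<Gamma>: "s \<in> carrier X" if "s \<in> \<Gamma>" for s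
    using basis that unfolding hilbert_basis_def by blast
  have h_closed: "h x \<in> carrier Y" if "x \<in> carrier X" for x
    using h that unfolding bmodule_hom_def by auto
  have h_Sup: "h (\<Squnion>\<^bsub>X\<^esub>A) = \<Squnion>\<^bsub>Y\<^esub>(h ` A)" if "A \<subseteq> carrier X" for A
    using h that unfolding bmodule_hom_def by auto
  have h_act: "h (b \<odot>\<^bsub>X\<^esub> x) = b \<odot>\<^bsub>Y\<^esub> h x" if "x \<in> carrier X" for b x
    using h that unfolding bmodule_hom_def by auto
  define k where
    "k = (\<lambda>y\<in>carrier Y. \<Squnion>\<^bsub>X\<^esub>((\<lambda>s. \<langle>h s, y\<rangle>\<^bsub>Y\<^esub> \<odot>\<^bsub>X\<^esub> s) ` \<Gamma>))"
  have sub: "(\<lambda>s. f s \<odot>\<^bsub>X\<^esub> s) ` \<Gamma> \<subseteq> carrier X" for f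
    using \<Gamma> X.act_closed by auto
  have k_closed: "k y \<in> carrier X" if "y \<in> carrier Y" for y
    using that sub by (simp add: k_def)
  have adj: "\<langle>h x, y\<rangle>\<^bsub>Y\<^esub> = \<langle>x, k y\<rangle>\<^bsub>X\<^esub>" if x: "x \<in> carrier X" and y: "y \<in> carrier Y" for x y
  proof -
    have "\<langle>x, k y\<rangle>\<^bsub>X\<^esub> = \<langle>k y, x\<rangle>\<^bsub>X\<^esub>"
      using X.ip_sym x k_closed[OF y] by blast
    also have "\<dots> = (SUP s\<in>\<Gamma>. \<langle>\<langle>h s, y\<rangle>\<^bsub>Y\<^esub> \<odot>\<^bsub>X\<^esub> s, x\<rangle>\<^bsub>X\<^esub>)"
      using y X.ip_Sup[OF sub x] by (simp add: k_def image_image)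
    also have "\<dots> = (SUP s\<in>\<Gamma>. \<langle>\<langle>x, s\<rangle>\<^bsub>X\<^esub> \<odot>\<^bsub>Y\<^esub> h s, y\<rangle>\<^bsub>Y\<^esub>)"
      using x y \<Gamma> h_closed X.ip_sym
      by (intro SUP_cong refl) (simp add: X.ip_act Y.ip_act inf.commute)
    also have "\<dots> = \<langle>\<Squnion>\<^bsub>Y\<^esub>((\<lambda>s. \<langle>x, s\<rangle>\<^bsub>X\<^esub> \<odot>\<^bsub>Y\<^esub> h s) ` \<Gamma>), y\<rangle>\<^bsub>Y\<^esub>"
      using Y.ip_Sup[of "(\<lambda>s. \<langle>x, s\<rangle>\<^bsub>X\<^esub> \<odot>\<^bsub>Y\<^esub> h s) ` \<Gamma>" y] y \<Gamma> h_closed Y.act_closed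
      by (auto simp: image_image image_subset_iff)
    also have "(\<lambda>s. \<langle>x, s\<rangle>\<^bsub>X\<^esub> \<odot>\<^bsub>Y\<^esub> h s) ` \<Gamma> = h ` (\<lambda>s. \<langle>x, s\<rangle>\<^bsub>X\<^esub> \<odot>\<^bsub>X\<^esub> s) ` \<Gamma>"
      unfolding image_image using \<Gamma> h_act by (intro image_cong refl) simp
    also have "\<Squnion>\<^bsub>Y\<^esub>\<dots> = h x"
      using h_Sup[OF sub] expand[OF x] by metis
    finally show ?thesis by simp
  qed
  have "is_adjoint X Y h k"
    using adj k_closed by (auto simp: is_adjoint_def k_def)
  moreover have "k1 = k2" if k1: "is_adjoint X Y h k1" and k2: "is_adjoint X Y h k2" for k1 k2
  proof (rule PiE_ext)
    show "k1 \<in> carrier Y \<rightarrow>\<^sub>E carrier X" "k2 \<in> carrier Y \<rightarrow>\<^sub>E carrier X"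
      using k1 k2 by (auto simp: is_adjoint_def)
    fix y assume y: "y \<in> carrier Y"
    have c: "k1 y \<in> carrier X" "k2 y \<in> carrier X"
      using k1 k2 y by (auto simp: is_adjoint_def)
    have "\<langle>k1 y, z\<rangle>\<^bsub>X\<^esub> = \<langle>k2 y, z\<rangle>\<^bsub>X\<^esub>" if z: "z \<in> carrier X" for z
      using k1 k2 y z c X.ip_sym unfolding is_adjoint_def by metis
    then show "k1 y = k2 y"
      using X.ip_nondegenerate c by blast
  qed
  ultimately show ?thesis by blast
qed


section \<open>Categories and strong self-dualities\<close>

text \<open>\<open>cmp C g f\<close> is the composite \<open>g \<circ> f\<close>, meaningful only if \<open>tgt C f = src C g\<close>.\<close>

record ('o, 'a) category =
  ob :: "'o set"
  ar :: "'a set"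
  src :: "'a \<Rightarrow> 'o"
  tgt :: "'a \<Rightarrow> 'o"
  idn :: "'o \<Rightarrow> 'a"
  cmp :: "'a \<Rightarrow> 'a \<Rightarrow> 'a"

locale category =
  fixes C :: "('o, 'a, 'm) category_scheme"
  assumes src_ob: "f \<in> ar C \<Longrightarrow> src C f \<in> ob C"
    and tgt_ob: "f \<in> ar C \<Longrightarrow> tgt C f \<in> ob C"
    and idn_ar: "X \<in> ob C \<Longrightarrow> idn C X \<in> ar C"
    and src_idn: "X \<in> ob C \<Longrightarrow> src C (idn C X) = X"
    and tgt_idn: "X \<in> ob C \<Longrightarrow> tgt C (idn C X) = X"
    and cmp_ar: "\<lbrakk>f \<in> ar C; g \<in> ar C; tgt C f = src C g\<rbrakk> \<Longrightarrow> cmp C g f \<in> ar C"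
    and src_cmp: "\<lbrakk>f \<in> ar C; g \<in> ar C; tgt C f = src C g\<rbrakk> \<Longrightarrow> src C (cmp C g f) = src C f"
    and tgt_cmp: "\<lbrakk>f \<in> ar C; g \<in> ar C; tgt C f = src C g\<rbrakk> \<Longrightarrow> tgt C (cmp C g f) = tgt C g"
    and cmp_idn_right: "f \<in> ar C \<Longrightarrow> cmp C f (idn C (src C f)) = f"
    and cmp_idn_left: "f \<in> ar C \<Longrightarrow> cmp C (idn C (tgt C f)) f = f"
    and cmp_assoc:
      "\<lbrakk>f \<in> ar C; g \<in> ar C; h \<in> ar C; tgt C f = src C g; tgt C g = src C h\<rbrakk>
       \<Longrightarrow> cmp C h (cmp C g f) = cmp C (cmp C h g) f"

definition op_category :: "('o, 'a) category \<Rightarrow> ('o, 'a) category"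
  where "op_category C =
    \<lparr>ob = ob C, ar = ar C, src = tgt C, tgt = src C, idn = idn C, cmp = (\<lambda>g f. cmp C f g)\<rparr>"

locale cat_functor = C: category C + D: category D
  for C :: "('o, 'a) category" and D :: "('p, 'c) category" +
  fixes F_ob :: "'o \<Rightarrow> 'p" and F_ar :: "'a \<Rightarrow> 'c"
  assumes F_ob: "X \<in> ob C \<Longrightarrow> F_ob X \<in> ob D"
    and F_ar: "f \<in> ar C \<Longrightarrow> F_ar f \<in> ar D"
    and F_src: "f \<in> ar C \<Longrightarrow> src D (F_ar f) = F_ob (src C f)"
    and F_tgt: "f \<in> ar C \<Longrightarrow> tgt D (F_ar f) = F_ob (tgt C f)"
    and F_idn: "X \<in> ob C \<Longrightarrow> F_ar (idn C X) = idn D (F_ob X)"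
    and F_cmp: "\<lbrakk>f \<in> ar C; g \<in> ar C; tgt C f = src C g\<rbrakk>
      \<Longrightarrow> F_ar (cmp C g f) = cmp D (F_ar g) (F_ar f)"

definition strong_self_duality :: "('o, 'a) category \<Rightarrow> ('a \<Rightarrow> 'a) \<Rightarrow> bool"
  where "strong_self_duality C F \<longleftrightarrow>
    cat_functor (op_category C) C (\<lambda>X. X) F \<and> (\<forall>h\<in>ar C. F (F h) = h)"


section \<open>The category of Hilbert modules with Hilbert bases\<close>

text \<open>The locale \<open>B\<close> is the type \<open>'b\<close>; the type \<open>'x\<close> plays the role of the universe in which the
  carriers of all modules live. An arrow from \<open>X\<close> to \<open>Y\<close> is a triple \<open>(X, h, Y)\<close>.\<close>

type_synonym ('x, 'b) hmb_arrow =
  "('x, 'b) hilbert_bmodule \<times> ('x \<Rightarrow> 'x) \<times> ('x, 'b) hilbert_bmodule"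

definition HMB :: "(('x, 'b::frame) hilbert_bmodule, ('x, 'b) hmb_arrow) category"
  where "HMB =
    (let Ob = {X. hilbert_bmodule X \<and> (\<exists>\<Gamma>. hilbert_basis X \<Gamma>)} in
    \<lparr>ob = Ob,
     ar = {(X, h, Y). X \<in> Ob \<and> Y \<in> Ob \<and> h \<in> bmodule_hom X Y},
     src = (\<lambda>(X, h, Y). X),
     tgt = (\<lambda>(X, h, Y). Y),
     idn = (\<lambda>X. (X, \<lambda>x\<in>carrier X. x, X)),
     cmp = (\<lambda>(Y, g, Z) (X, f, Y'). (X, compose (carrier X) g f, Z))\<rparr>)"

definition dagger :: "('x, 'b::frame) hmb_arrow \<Rightarrow> ('x, 'b) hmb_arrow"
  where "dagger = (\<lambda>(X, h, Y). (Y, adjoint X Y h, X))"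

end

(* By non-degeneracy every adjoint preserves joins and the action, so the adjoint of a homomorphism
   is again an arrow. By symmetry of the inner products the adjunction identity is symmetric, and
   adjunction identities compose; uniqueness of adjoints turns these facts into involutivity and
   functoriality. *)
theory Submission
  imports Defs
begin

section \<open>The inner product in its second argument\<close>

lemma (in hilbert_bmodule) ip_Sup_right:
  assumes "A \<subseteq> carrier X" and "x \<in> carrier X"
  shows "\<langle>x, \<Squnion>A\<rangle> = (SUP y\<in>A. \<langle>x, y\<rangle>)"
proof -
  have "\<langle>x, \<Squnion>A\<rangle> = \<langle>\<Squnion>A, x\<rangle>"
    using assms by (simp add: ip_sym)
  also have "\<dots> = (SUP y\<in>A. \<langle>y, x\<rangle>)"
    using assms by (rule ip_Sup)
  also have "\<dots> = (SUP y\<in>A. \<langle>x, y\<rangle>)"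
    using assms ip_sym by (intro SUP_cong refl) auto
  finally show ?thesis .
qed

lemma (in hilbert_bmodule) ip_act_right:
  assumes "x \<in> carrier X" and "y \<in> carrier X"
  shows "\<langle>x, b \<odot> y\<rangle> = inf b \<langle>x, y\<rangle>"
  using assms ip_act ip_sym act_closed by metis

text \<open>An adjunction identity determines \<open>k y\<close> only through its pairings <x, k y>,
  so non-degeneracy is wanted with the test element on the left.\<close>

lemma (in hilbert_bmodule) ip_nondegenerate_right:
  assumes "x \<in> carrier X" and "y \<in> carrier X"
    and "\<And>z. z \<in> carrier X \<Longrightarrow> \<langle>z, x\<rangle> = \<langle>z, y\<rangle>"
  shows "x = y"
  using assms ip_sym by (intro ip_nondegenerate) metis+

section \<open>Homomorphisms, their identities and composites\<close>

lemma bmodule_homI: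
  assumes "h \<in> carrier X \<rightarrow>\<^sub>E carrier Y"
    and "\<And>A. A \<subseteq> carrier X \<Longrightarrow> h (\<Squnion>\<^bsub>X\<^esub>A) = \<Squnion>\<^bsub>Y\<^esub>(h ` A)"
    and "\<And>b x. x \<in> carrier X \<Longrightarrow> h (b \<odot>\<^bsub>X\<^esub> x) = b \<odot>\<^bsub>Y\<^esub> h x"
  shows "h \<in> bmodule_hom X Y"
  using assms by (simp add: bmodule_hom_def)

lemma bmodule_hom_PiE: "h \<in> bmodule_hom X Y \<Longrightarrow> h \<in> carrier X \<rightarrow>\<^sub>E carrier Y"
  by (simp add: bmodule_hom_def)

lemma bmodule_hom_closed: "h \<in> bmodule_hom X Y \<Longrightarrow> x \<in> carrier X \<Longrightarrow> h x \<in> carrier Y"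
  by (auto simp: bmodule_hom_def)

lemma bmodule_hom_Pi: "h \<in> bmodule_hom X Y \<Longrightarrow> h \<in> carrier X \<rightarrow> carrier Y"
  by (auto simp: bmodule_hom_def)

lemma bmodule_hom_extensional: "h \<in> bmodule_hom X Y \<Longrightarrow> h \<in> extensional (carrier X)"
  by (auto simp: bmodule_hom_def PiE_def)

lemma bmodule_hom_Sup:
  "h \<in> bmodule_hom X Y \<Longrightarrow> A \<subseteq> carrier X \<Longrightarrow> h (\<Squnion>\<^bsub>X\<^esub>A) = \<Squnion>\<^bsub>Y\<^esub>(h ` A)"
  by (simp add: bmodule_hom_def)

lemma bmodule_hom_act:
  "h \<in> bmodule_hom X Y \<Longrightarrow> x \<in> carrier X \<Longrightarrow> h (b \<odot>\<^bsub>X\<^esub> x) = b \<odot>\<^bsub>Y\<^esub> h x"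
  by (simp add: bmodule_hom_def)

text \<open>The restricted identity is \<open>undefined\<close> off the carrier, so its laws rest on
  closure of the carrier under joins and the action; the module axioms enter through this closure.
  The same holds for \<open>compose\<close> below.\<close>

lemma bmodule_hom_id:
  assumes "bmodule X"
  shows "(\<lambda>x\<in>carrier X. x) \<in> bmodule_hom X X"
proof -
  interpret bmodule X by (rule assms)
  show ?thesis
  proof (rule bmodule_homI)
    fix A assume A: "A \<subseteq> carrier X"
    then have "(\<lambda>x\<in>carrier X. x) ` A = A"
      by (auto simp: subset_iff image_iff)
    then show "(\<lambda>x\<in>carrier X. x) (\<Squnion>\<^bsub>X\<^esub>A) = \<Squnion>\<^bsub>X\<^esub>((\<lambda>x\<in>carrier X. x) ` A)"
      using A by simp
  qed (auto simp: act_closed)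
qed

lemma bmodule_hom_compose:
  assumes X: "bmodule X" and f: "f \<in> bmodule_hom X Y" and g: "g \<in> bmodule_hom Y Z"
  shows "compose (carrier X) g f \<in> bmodule_hom X Z"
proof -
  interpret bmodule X by (rule X)
  show ?thesis
  proof (rule bmodule_homI)
    show "compose (carrier X) g f \<in> carrier X \<rightarrow>\<^sub>E carrier Z"
      using bmodule_hom_closed[OF f] bmodule_hom_closed[OF g] by (auto simp: compose_def)
  next
    fix A assume A: "A \<subseteq> carrier X"
    then have "compose (carrier X) g f ` A = g ` f ` A"
      by (auto simp: compose_eq subset_iff image_iff)
    moreover have "f ` A \<subseteq> carrier Y"
      using A bmodule_hom_closed[OF f] by auto
    ultimately show "compose (carrier X) g f (\<Squnion>\<^bsub>X\<^esub>A) = \<Squnion>\<^bsub>Z\<^esub>(compose (carrier X) g f ` A)"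
      using A by (simp add: compose_eq bmodule_hom_Sup[OF f] bmodule_hom_Sup[OF g])
  next
    fix b x assume "x \<in> carrier X"
    then show "compose (carrier X) g f (b \<odot>\<^bsub>X\<^esub> x) = b \<odot>\<^bsub>Z\<^esub> compose (carrier X) g f x"
      by (simp add: compose_eq act_closed bmodule_hom_act[OF f] bmodule_hom_act[OF g]
          bmodule_hom_closed[OF f])
  qed
qed

section \<open>Adjoint pairs of maps\<close>

text \<open>Pairing with an arbitrary \<open>x\<close> turns \<open>k y\<close> into <h x, y>, an
  expression that preserves joins and the action in \<open>y\<close>. Non-degeneracy of
  \<open>X\<close> then removes \<open>x\<close>.\<close>

lemma is_adjoint_hom:
  assumes X: "hilbert_bmodule X" and Y: "hilbert_bmodule Y"
    and h: "h \<in> carrier X \<rightarrow> carrier Y" and k: "is_adjoint X Y h k"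
  shows "k \<in> bmodule_hom Y X"
proof -
  interpret X: hilbert_bmodule X by (rule X)
  interpret Y: hilbert_bmodule Y by (rule Y)
  \<comment> \<open>The identity \<open>adj\<close> is oriented so that rewriting with it eliminates
    \<open>k\<close> from the pairings.\<close>
  have k_PiE: "k \<in> carrier Y \<rightarrow>\<^sub>E carrier X"
    and adj: "\<And>x y. x \<in> carrier X \<Longrightarrow> y \<in> carrier Y \<Longrightarrow> \<langle>x, k y\<rangle>\<^bsub>X\<^esub> = \<langle>h x, y\<rangle>\<^bsub>Y\<^esub>"
    using k by (simp_all add: is_adjoint_def)
  have kc: "k y \<in> carrier X" if "y \<in> carrier Y" for y
    using k_PiE that by auto
  have hc: "h x \<in> carrier Y" if "x \<in> carrier X" for x
    using h that by auto
  show ?thesis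
  proof (rule bmodule_homI[OF k_PiE])
    fix A assume A: "A \<subseteq> carrier Y"
    then have kA: "k ` A \<subseteq> carrier X"
      using kc by auto
    show "k (\<Squnion>\<^bsub>Y\<^esub>A) = \<Squnion>\<^bsub>X\<^esub>(k ` A)"
    proof (rule X.ip_nondegenerate_right)
      show "k (\<Squnion>\<^bsub>Y\<^esub>A) \<in> carrier X" "\<Squnion>\<^bsub>X\<^esub>(k ` A) \<in> carrier X"
        using kc A kA by simp_all
      fix x assume x: "x \<in> carrier X"
      have "\<langle>x, k (\<Squnion>\<^bsub>Y\<^esub>A)\<rangle>\<^bsub>X\<^esub> = (SUP y\<in>A. \<langle>h x, y\<rangle>\<^bsub>Y\<^esub>)"
        using x A hc by (simp add: adj Y.ip_Sup_right)
      also have "\<dots> = (SUP y\<in>A. \<langle>x, k y\<rangle>\<^bsub>X\<^esub>)"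
        using x A adj by (intro SUP_cong refl) auto
      also have "\<dots> = \<langle>x, \<Squnion>\<^bsub>X\<^esub>(k ` A)\<rangle>\<^bsub>X\<^esub>"
        using x kA by (simp add: X.ip_Sup_right image_image)
      finally show "\<langle>x, k (\<Squnion>\<^bsub>Y\<^esub>A)\<rangle>\<^bsub>X\<^esub> = \<langle>x, \<Squnion>\<^bsub>X\<^esub>(k ` A)\<rangle>\<^bsub>X\<^esub>" .
    qed
  next
    fix b y assume y: "y \<in> carrier Y"
    show "k (b \<odot>\<^bsub>Y\<^esub> y) = b \<odot>\<^bsub>X\<^esub> k y"
      \<comment> \<open>Paired with any \<open>x\<close>, both sides become the meet of
        \<open>b\<close> with <h x, y>.\<close>
      using y by (intro X.ip_nondegenerate_right)
        (simp_all add: adj kc hc X.act_closed Y.act_closed X.ip_act_right Y.ip_act_right)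
  qed
qed

text \<open><k y, x> = <x, k y> = <h x, y> = <y, h x>. Here \<open>h\<close> takes the role of the
  adjoint, which \<open>is_adjoint\<close> requires to be extensional; hence
  \<open>\<rightarrow>\<^sub>E\<close> in its typing.\<close>

lemma is_adjoint_sym:
  assumes X: "hilbert_bmodule X" and Y: "hilbert_bmodule Y"
    and h: "h \<in> carrier X \<rightarrow>\<^sub>E carrier Y" and k: "is_adjoint X Y h k"
  shows "is_adjoint Y X k h"
proof -
  interpret X: hilbert_bmodule X by (rule X)
  interpret Y: hilbert_bmodule Y by (rule Y)
  have "\<langle>k y, x\<rangle>\<^bsub>X\<^esub> = \<langle>y, h x\<rangle>\<^bsub>Y\<^esub>" if x: "x \<in> carrier X" and y: "y \<in> carrier Y" for x y
  proof -
    have "k y \<in> carrier X" "h x \<in> carrier Y"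
      using h k x y by (auto simp: is_adjoint_def)
    then show ?thesis
      using k x y X.ip_sym Y.ip_sym by (metis is_adjoint_def)
  qed
  then show ?thesis
    using h by (simp add: is_adjoint_def)
qed

lemma is_adjoint_id: "is_adjoint X X (\<lambda>x\<in>carrier X. x) (\<lambda>x\<in>carrier X. x)"
  by (simp add: is_adjoint_def)

text \<open><g (f x), z> = <f x, g' z> = <x, f' (g' z)>: moving the maps across one at a time
  reverses their order.\<close>

lemma is_adjoint_compose:
  assumes "f \<in> carrier X \<rightarrow> carrier Y" and "is_adjoint X Y f f'" and "is_adjoint Y Z g g'"
  shows "is_adjoint X Z (compose (carrier X) g f) (compose (carrier Z) f' g')"
proof -
  have "f x \<in> carrier Y" if "x \<in> carrier X" for x
    using assms(1) that by auto
  moreover have "g' z \<in> carrier Y" if "z \<in> carrier Z" for z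
    using assms(3) that by (auto simp: is_adjoint_def)
  moreover have "f' y \<in> carrier X" if "y \<in> carrier Y" for y
    using assms(2) that by (auto simp: is_adjoint_def)
  ultimately show ?thesis
    using assms(2,3) by (simp add: is_adjoint_def compose_def)
qed

section \<open>The category of Hilbert modules and its opposite\<close>

lemma ob_HMB: "X \<in> ob HMB \<longleftrightarrow> hilbert_bmodule X \<and> (\<exists>\<Gamma>. hilbert_basis X \<Gamma>)"
  by (simp add: HMB_def)

lemma ar_HMB: "(X, h, Y) \<in> ar HMB \<longleftrightarrow> X \<in> ob HMB \<and> Y \<in> ob HMB \<and> h \<in> bmodule_hom X Y"
  by (simp add: HMB_def)

lemma HMB_simps [simp]:
  "src HMB (X, h, Y) = X"
  "tgt HMB (X, h, Y) = Y"
  "idn HMB X = (X, \<lambda>x\<in>carrier X. x, X)"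
  "cmp HMB (Y', g, Z) (X, h, Y) = (X, compose (carrier X) g h, Z)"
  by (simp_all add: HMB_def)

lemma ob_HMB_bmodule: "X \<in> ob HMB \<Longrightarrow> bmodule X"
  by (simp add: ob_HMB hilbert_bmodule.axioms(1))

lemma category_HMB:
  "category (HMB :: (('x, 'b::frame) hilbert_bmodule, ('x, 'b) hmb_arrow) category)"
proof
  fix f g h :: "('x, 'b) hmb_arrow"
  assume *: "f \<in> ar HMB" "g \<in> ar HMB" "h \<in> ar HMB"
    "tgt HMB f = src HMB g" "tgt HMB g = src HMB h"
  \<comment> \<open>Composability forces neighbouring triples to share their middle objects.\<close>
  obtain X f' Y g' Z h' W where "f = (X, f', Y)" "g = (Y, g', Z)" "h = (Z, h', W)"
    using * by (metis HMB_simps(1,2) prod_cases3)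
  then show "cmp HMB h (cmp HMB g f) = cmp HMB (cmp HMB h g) f"
    using * bmodule_hom_closed by (fastforce simp: ar_HMB intro!: compose_assoc)
next
  fix f :: "('x, 'b) hmb_arrow"
  assume f: "f \<in> ar HMB"
  then obtain X f' Y where f': "f = (X, f', Y)" "f' \<in> bmodule_hom X Y"
    by (metis ar_HMB prod_cases3)
  \<comment> \<open>The identity laws are equalities of HOL functions: composing with an identity
    restricts \<open>f'\<close> to \<open>carrier X\<close>, and extensionality makes this
    restriction equal to \<open>f'\<close>.\<close>
  have "f' \<in> carrier X \<rightarrow> carrier Y" "f' \<in> extensional (carrier X)"
    using f' by (simp_all add: bmodule_hom_Pi bmodule_hom_extensional)
  then show "cmp HMB f (idn HMB (src HMB f)) = f" "cmp HMB (idn HMB (tgt HMB f)) f = f"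
    using f' by (simp_all add: compose_Id Id_compose)
qed (auto simp: ar_HMB ob_HMB_bmodule bmodule_hom_id bmodule_hom_compose)

lemma category_op_category:
  assumes "category C"
  shows "category (op_category C)"
proof -
  interpret category C by (rule assms)
  show ?thesis
    by unfold_locales
      (simp_all add: op_category_def src_ob tgt_ob idn_ar src_idn tgt_idn cmp_ar src_cmp tgt_cmp
        cmp_idn_right cmp_idn_left cmp_assoc)
qed

section \<open>Adjoints of arrows\<close>

lemma HMB_adjoint_ex1:
  assumes "X \<in> ob HMB" and "Y \<in> ob HMB" and "h \<in> bmodule_hom X Y"
  shows "\<exists>!k. is_adjoint X Y h k"
proof -
  obtain \<Gamma> where "hilbert_basis X \<Gamma>"
    using assms(1) unfolding ob_HMB by blast
  moreover have "hilbert_bmodule X" "hilbert_bmodule Y"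
    using assms(1,2) unfolding ob_HMB by simp_all
  ultimately show ?thesis
    using assms(3) adjoint_ex1 by metis
qed

text \<open>Uniqueness in the form used for involutivity, identities and composites: a candidate is
  the adjoint once it satisfies the adjunction identity.\<close>

lemma adjoint_eqI:
  assumes "X \<in> ob HMB" and "Y \<in> ob HMB" and "h \<in> bmodule_hom X Y" and "is_adjoint X Y h k"
  shows "adjoint X Y h = k"
  unfolding adjoint_def using HMB_adjoint_ex1[OF assms(1-3)] assms(4)
  by (rule the1_equality[where P = "is_adjoint X Y h"])

lemma is_adjoint_adjoint:
  assumes "X \<in> ob HMB" and "Y \<in> ob HMB" and "h \<in> bmodule_hom X Y"
  shows "is_adjoint X Y h (adjoint X Y h)"
  unfolding adjoint_def by (rule theI'[OF HMB_adjoint_ex1[OF assms]])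

lemma adjoint_hom:
  assumes "X \<in> ob HMB" and "Y \<in> ob HMB" and "h \<in> bmodule_hom X Y"
  shows "adjoint X Y h \<in> bmodule_hom Y X"
proof (rule is_adjoint_hom)
  show "h \<in> carrier X \<rightarrow> carrier Y"
    using assms(3) by (rule bmodule_hom_Pi)
  show "is_adjoint X Y h (adjoint X Y h)"
    using assms by (rule is_adjoint_adjoint)
qed (use assms in \<open>simp_all add: ob_HMB\<close>)

lemma adjoint_adjoint:
  assumes "X \<in> ob HMB" and "Y \<in> ob HMB" and "h \<in> bmodule_hom X Y"
  shows "adjoint Y X (adjoint X Y h) = h"
proof (rule adjoint_eqI)
  \<comment> \<open>Uniqueness is applied to the map \<open>adjoint X Y h\<close> from
    \<open>Y\<close> to \<open>X\<close>, which must therefore itself be a homomorphism.\<close>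
  show "adjoint X Y h \<in> bmodule_hom Y X"
    using assms by (rule adjoint_hom)
  show "is_adjoint Y X (adjoint X Y h) h"
  proof (rule is_adjoint_sym)
    show "h \<in> carrier X \<rightarrow>\<^sub>E carrier Y"
      using assms(3) by (rule bmodule_hom_PiE)
    show "is_adjoint X Y h (adjoint X Y h)"
      using assms by (rule is_adjoint_adjoint)
  qed (use assms in \<open>simp_all add: ob_HMB\<close>)
qed fact+

lemma adjoint_id:
  assumes "X \<in> ob HMB"
  shows "adjoint X X (\<lambda>x\<in>carrier X. x) = (\<lambda>x\<in>carrier X. x)"
  using assms by (intro adjoint_eqI is_adjoint_id bmodule_hom_id ob_HMB_bmodule)

lemma adjoint_compose:
  assumes "X \<in> ob HMB" and "Y \<in> ob HMB" and "Z \<in> ob HMB"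
    and "f \<in> bmodule_hom X Y" and "g \<in> bmodule_hom Y Z"
  shows "adjoint X Z (compose (carrier X) g f)
    = compose (carrier Z) (adjoint X Y f) (adjoint Y Z g)"
proof (rule adjoint_eqI)
  show "compose (carrier X) g f \<in> bmodule_hom X Z"
    using ob_HMB_bmodule[OF assms(1)] assms(4,5) by (rule bmodule_hom_compose)
  show "is_adjoint X Z (compose (carrier X) g f)
      (compose (carrier Z) (adjoint X Y f) (adjoint Y Z g))"
    using bmodule_hom_Pi[OF assms(4)] is_adjoint_adjoint[OF assms(1,2,4)]
      is_adjoint_adjoint[OF assms(2,3,5)]
    by (rule is_adjoint_compose)
qed fact+

lemma dagger_simp [simp]: "dagger (X, h, Y) = (Y, adjoint X Y h, X)"
  by (simp add: dagger_def)

theorem corollary4p6: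
  shows "strong_self_duality
    (HMB :: (('x, 'b::frame) hilbert_bmodule, ('x, 'b) hmb_arrow) category) dagger"
proof -
  let ?C = "HMB :: (('x, 'b) hilbert_bmodule, ('x, 'b) hmb_arrow) category"
  interpret C: category ?C by (rule category_HMB)
  interpret op: category "op_category ?C" by (rule category_op_category) (rule category_HMB)
  have "cat_functor (op_category ?C) ?C (\<lambda>X. X) dagger"
    \<comment> \<open>The opposite category swaps source and target and flips composition, so that
      closure on arrows, identities and composites become \<open>adjoint_hom\<close>,
      \<open>adjoint_id\<close> and \<open>adjoint_compose\<close>.\<close>
    by unfold_locales
      (auto simp: op_category_def ar_HMB adjoint_hom adjoint_id adjoint_compose)
  then show ?thesis
    by (auto simp: strong_self_duality_def ar_HMB adjoint_adjoint)
qed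

end
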